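(* Let $k\ge 2$ be an integer, and let $S_k^-=\{1,2,\ldots,k-2,k\}$ (so $S_2^-=\{2\}$). For every integer $n\ge k$, $$red^{S_k^-}(n) > rod^{S_k^-}(n)\ \text{ if } k \text{ is even},\qquad rod^{S_k^-}(n) > red^{S_k^-}(n)\ \text{ if } k \text{ is odd}.$$
   Context: A partition is a finite, nonempty, nonincreasing sequence of positive integers called its parts. The perimeter of a partition $\pi$ is $\alpha_\pi+\lambda_\pi-1$, where $\alpha_\pi$ is the largest part of $\pi$ and $\lambda_\pi$ is the number of parts of $\pi$ (counted with multiplicity). For a set $S$ of positive integers, $red^S(n)$ is the number of partitions of perimeter $n$ with no parts from $S$ in which the even parts are distinct (no even part is repeated; odd parts are unrestricted), and $rod^S(n)$ is the number of partitions of perimeter $n$ with no parts from $S$ in which the odd parts are distinct (no odd part is repeated; even parts are unrestricted). *)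

theory Defs
  imports Main
begin

definition is_partition :: "nat list \<Rightarrow> bool" where
  "is_partition p \<longleftrightarrow> p \<noteq> [] \<and> sorted_wrt (\<ge>) p \<and> (\<forall>x\<in>set p. 0 < x)"

definition largest_part :: "nat list \<Rightarrow> nat" where
  "largest_part p = Max (set p)"

definition num_parts :: "nat list \<Rightarrow> nat" where
  "num_parts p = length p"

text \<open>The truncated subtraction is harmless: for a partition both summands are at least 1.\<close>

definition perimeter :: "nat list \<Rightarrow> nat" where
  "perimeter p = largest_part p + num_parts p - 1"

definition red_partitions :: "nat set \<Rightarrow> nat \<Rightarrow> nat list set" where
  "red_partitions S n =
     {p. is_partition p \<and> perimeter p = n \<and> set p \<inter> S = {} \<and> distinct (filter even p)}"

definition rod_partitions :: "nat set \<Rightarrow> nat \<Rightarrow> nat list set" where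
  "rod_partitions S n =
     {p. is_partition p \<and> perimeter p = n \<and> set p \<inter> S = {} \<and> distinct (filter odd p)}"

definition red :: "nat set \<Rightarrow> nat \<Rightarrow> nat" where
  "red S n = card (red_partitions S n)"

definition rod :: "nat set \<Rightarrow> nat \<Rightarrow> nat" where
  "rod S n = card (rod_partitions S n)"

text \<open>The set \<open>{1, 2, \<dots>, k - 2, k}\<close>, used for \<open>k \<ge> 2\<close>; the interval is empty for \<open>k = 2\<close>.\<close>

definition S_minus :: "nat \<Rightarrow> nat set" where
  "S_minus k = {1..k - 2} \<union> {k}"

text \<open>The sets counted above are finite, so \<open>card\<close> is the true number of elements.\<close>

lemma finite_partitions_perimeter: "finite {p. is_partition p \<and> perimeter p = n}"
proof (rule finite_subset)
  show "{p. is_partition p \<and> perimeter p = n} \<subseteq> {p. set p \<subseteq> {..n} \<and> length p \<le> n}"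
  proof clarify
    fix p assume p: "is_partition p" and n: "n = perimeter p"
    have ne: "p \<noteq> []" and pos: "\<forall>x\<in>set p. 0 < x"
      using p by (auto simp: is_partition_def)
    have max: "x \<le> Max (set p)" if "x \<in> set p" for x
      using that by simp
    have "0 < Max (set p)" using ne pos by simp
    moreover have "0 < length p" using ne by simp
    ultimately have "Max (set p) \<le> perimeter p" "length p \<le> perimeter p"
      by (auto simp: perimeter_def largest_part_def num_parts_def simp del: length_greater_0_conv)
    with max show "set p \<subseteq> {..perimeter p} \<and> length p \<le> perimeter p"
      by (meson atMost_iff le_trans subsetI)
  qed
  show "finite {p. set p \<subseteq> {..n} \<and> length p \<le> n}"
    by (rule finite_lists_length_le) simp
qed

lemma finite_red_partitions: "finite (red_partitions S n)"
  by (rule finite_subset[OF _ finite_partitions_perimeter[of n]]) (auto simp: red_partitions_def)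

lemma finite_rod_partitions: "finite (rod_partitions S n)"
  by (rule finite_subset[OF _ finite_partitions_perimeter[of n]]) (auto simp: rod_partitions_def)

end

theory Submission
  imports Defs "HOL-Library.Multiset"
begin

text \<open>
  Call a value \<open>v\<close> of the first kind if \<open>v + k\<close> is odd, and of the second kind otherwise. With
  \<open>S = S_minus k\<close> the permitted parts are \<open>k - 1\<close> and everything above \<open>k\<close>, so the smallest permitted
  part is of the first kind. Both cases of the theorem are therefore the same assertion: more
  partitions have distinct parts of the second kind (the set \<open>F\<close>) than have distinct parts of the
  first kind (the set \<open>G\<close>). It is proved by an injection from \<open>G\<close> to \<open>F\<close> that preserves the perimeter
  and misses an element of \<open>F\<close>.

  The permitted values above \<open>k\<close> fall into neighbouring pairs \<open>k + 1, k + 2\<close>, then \<open>k + 3, k + 4\<close>,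
  and so on, of the first and second kind. Let \<open>M\<close> be the largest value of the first kind that does
  not exceed the largest part. All pairs below \<open>M\<close> can simply exchange their multiplicities, which
  turns distinctness in one kind into distinctness in the other (\<open>swap_parts\<close>). Only \<open>k - 1\<close>, \<open>M\<close> and
  \<open>M + 1\<close> are unaffected. The first two may be repeated in \<open>F\<close>, so the single obstacle is a largest
  part \<open>M + 1\<close> that is repeated.

  In that case let \<open>s, t \<le> 1\<close> and \<open>r \<ge> 2\<close> be the multiplicities of \<open>k - 1\<close>, \<open>M\<close> and \<open>M + 1\<close>. Replace
  them by \<open>s + 2 t\<close>, \<open>r + 1 - t\<close> and \<open>0\<close> (\<open>lower_top\<close>). The largest part drops by one and the number of
  parts grows by one, so the perimeter stays the same. The pair \<open>s, t\<close> is recovered as the binary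
  digits of \<open>s + 2 t\<close>, and then \<open>r\<close> is known too. The new multiplicity of the largest part \<open>M\<close> is at least
  2, whereas \<open>M\<close> is never repeated in an unmodified partition; so the two cases cannot collide, and the
  map is injective (\<open>lower_top_inj\<close>).

  For \<open>n \<ge> k\<close> every element of \<open>G\<close> has a part above \<open>k\<close>, because \<open>k - 1\<close> occurs at most once; the image
  then has such a part as well. The partition into \<open>n - k + 2\<close> copies of \<open>k - 1\<close> lies in \<open>F\<close> and is
  missed (\<open>card_other_parity_less\<close>).
\<close>

section \<open>Partitions as multisets\<close>

definition partition_msets :: "nat set \<Rightarrow> (nat \<Rightarrow> bool) \<Rightarrow> nat \<Rightarrow> nat multiset set" where
  "partition_msets S P n =
     {X. X \<noteq> {#} \<and> 0 \<notin># X \<and> set_mset X \<inter> S = {} \<and> Max_mset X + size X = Suc n \<and>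
         (\<forall>v. P v \<longrightarrow> count X v \<le> 1)}"

lemma distinct_iff_count_le_1: "distinct p \<longleftrightarrow> (\<forall>v. count (mset p) v \<le> 1)"
proof (induction p)
  case (Cons x p)
  have "x \<in> set p \<longleftrightarrow> 0 < count (mset p) x" by simp
  with Cons show ?case by (auto simp: not_in_iff le_Suc_eq)
qed simp

lemma distinct_filter_iff_count:
  "distinct (filter P p) \<longleftrightarrow> (\<forall>v. P v \<longrightarrow> count (mset p) v \<le> 1)"
  by (simp add: distinct_iff_count_le_1)

text \<open>
  The order of the parts carries no information, and multisets spare the injection any sorting.
\<close>

lemma bij_betw_mset_partitions:
  "bij_betw mset
     {p. is_partition p \<and> perimeter p = n \<and> set p \<inter> S = {} \<and> distinct (filter P p)}
     (partition_msets S P n)" (is "bij_betw mset ?L ?R")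
proof (rule bij_betwI')
  fix p q assume "p \<in> ?L" "q \<in> ?L"
  then have "sorted (rev p)" "sorted (rev q)"
    by (auto simp: is_partition_def sorted_wrt_rev)
  then show "mset p = mset q \<longleftrightarrow> p = q"
    by (metis mset_rev properties_for_sort rev_rev_ident)
next
  fix p assume p: "p \<in> ?L"
  then have "0 < length p" by (simp add: is_partition_def)
  with p show "mset p \<in> ?R"
    by (auto simp: partition_msets_def is_partition_def perimeter_def largest_part_def
        num_parts_def distinct_filter_iff_count simp del: length_greater_0_conv)
next
  fix X assume X: "X \<in> ?R"
  define p where "p = rev (sorted_list_of_multiset X)"
  have mset: "mset p = X" by (simp add: p_def)
  then have set: "set p = set_mset X" and len: "length p = size X"
    by (metis set_mset_mset, metis size_mset)
  have "sorted_wrt (\<ge>) p"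
    by (simp add: p_def sorted_wrt_rev sorted_sorted_list_of_multiset)
  moreover have "p \<noteq> []" using X mset by (auto simp: partition_msets_def)
  moreover have "\<forall>x\<in>set p. 0 < x" using X set by (auto simp: partition_msets_def intro: gr0I)
  ultimately have "p \<in> ?L"
    using X mset set len
    by (auto simp: partition_msets_def is_partition_def perimeter_def largest_part_def
        num_parts_def distinct_filter_iff_count)
  with mset show "\<exists>p\<in>?L. X = mset p" by blast
qed

lemma red_eq_card: "red S n = card (partition_msets S even n)"
  and rod_eq_card: "rod S n = card (partition_msets S odd n)"
  unfolding red_def red_partitions_def rod_def rod_partitions_def
  by (rule bij_betw_same_card[OF bij_betw_mset_partitions])+

lemma finite_partition_msets: "finite (partition_msets S P n)"
proof -
  have "finite {p. is_partition p \<and> perimeter p = n \<and> set p \<inter> S = {} \<and> distinct (filter P p)}"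
    by (rule finite_subset[OF _ finite_partitions_perimeter[of n]]) auto
  then show ?thesis using bij_betw_finite[OF bij_betw_mset_partitions] by blast
qed

section \<open>Exchanging neighbouring values of different parity\<close>

text \<open>
  The value \<open>M\<close> of the introduction.
\<close>

definition apex :: "nat \<Rightarrow> nat multiset \<Rightarrow> nat" where
  "apex k X = (if odd (Max_mset X + k) then Max_mset X else Max_mset X - 1)"

text \<open>
  Having a part above \<open>k\<close> ensures \<open>k < M\<close>, so that \<open>k - 1\<close> and the values \<open>M\<close>, \<open>M + 1\<close> do not overlap.
\<close>

definition admissible :: "nat \<Rightarrow> nat multiset \<Rightarrow> bool" where
  "admissible k X \<longleftrightarrow> (\<exists>v\<in>#X. k < v) \<and> (\<forall>v\<in>#X. v = k - 1 \<or> k < v)"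

lemma apex_cases:
  assumes "admissible k X"
  shows "odd (apex k X + k)" "k < apex k X"
    "Max_mset X = apex k X \<or> Max_mset X = Suc (apex k X)"
proof -
  obtain v where v: "v \<in># X" "k < v" using assms by (auto simp: admissible_def)
  then have "v \<le> Max_mset X" by simp
  with v have k: "k < Max_mset X" by linarith
  then obtain m where m: "Max_mset X = Suc m" by (cases "Max_mset X") auto
  show "odd (apex k X + k)" "Max_mset X = apex k X \<or> Max_mset X = Suc (apex k X)"
    using m by (auto simp: apex_def)
  show "k < apex k X" using k m by (auto simp: apex_def less_Suc_eq)
qed

lemma Max_mset_eqI: "m \<in># X \<Longrightarrow> (\<And>v. v \<in># X \<Longrightarrow> v \<le> m) \<Longrightarrow> Max_mset X = (m::nat)"
  by (rule Max_eqI) auto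

definition swap_value :: "nat \<Rightarrow> nat \<Rightarrow> nat \<Rightarrow> nat" where
  "swap_value k M v = (if k < v \<and> v < M then (if odd (v + k) then v + 1 else v - 1) else v)"

text \<open>
  The values strictly between \<open>k\<close> and \<open>M\<close> number \<open>M - k - 1\<close>, which is even, so they split into whole
  pairs and the exchange does not leave this range.
\<close>

lemma swap_value_range:
  assumes "odd (M + k)" "k < v" "v < M"
  shows "k < swap_value k M v" "swap_value k M v < M"
    "odd (swap_value k M v + k) \<longleftrightarrow> even (v + k)"
proof -
  have "Suc v \<noteq> M" if "odd (v + k)" using that assms(1) by auto
  moreover have "v \<noteq> Suc k" if "even (v + k)" using that by auto
  moreover obtain w where "v = Suc w" using assms(2) by (cases v) auto
  ultimately show "k < swap_value k M v" "swap_value k M v < M"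
    "odd (swap_value k M v + k) \<longleftrightarrow> even (v + k)"
    using assms(2,3) by (auto simp: swap_value_def)
qed

lemma swap_value_involution:
  assumes "odd (M + k)"
  shows "swap_value k M (swap_value k M v) = v"
proof (cases "k < v \<and> v < M")
  case True
  with swap_value_range[OF assms, of v] show ?thesis
    by (auto simp: swap_value_def split: if_splits)
next
  case False
  then show ?thesis by (auto simp: swap_value_def)
qed

lemma count_image_swap_value:
  assumes "odd (M + k)"
  shows "count (image_mset (swap_value k M) X) v = count X (swap_value k M v)"
proof -
  have "swap_value k M u = v \<longleftrightarrow> u = swap_value k M v" for u
    using swap_value_involution[OF assms] by metis
  then show ?thesis by (induction X) auto
qed

definition swap_parts :: "nat \<Rightarrow> nat multiset \<Rightarrow> nat multiset" where
  "swap_parts k X = image_mset (swap_value k (apex k X)) X"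

text \<open>
  The largest part is \<open>M\<close> or \<open>M + 1\<close> and is not moved, and everything below \<open>M\<close> stays below \<open>M\<close>. Hence
  the exchange preserves \<open>M\<close>, which is what makes it an involution although it depends on \<open>M\<close>.
\<close>

lemma swap_parts_properties:
  assumes "admissible k X"
  shows "admissible k (swap_parts k X)" "Max_mset (swap_parts k X) = Max_mset X"
    "apex k (swap_parts k X) = apex k X"
proof -
  note A = apex_cases[OF assms]
  have ne: "X \<noteq> {#}" using assms by (auto simp: admissible_def)
  then have mem: "Max_mset X \<in># X" by simp
  have top: "swap_value k (apex k X) (Max_mset X) = Max_mset X"
    using A(3) by (auto simp: swap_value_def)
  have gt: "k < swap_value k (apex k X) v" if "k < v" for v
    using that swap_value_range[OF A(1), of v] by (cases "v < apex k X") (auto simp: swap_value_def)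
  have low: "swap_value k (apex k X) (k - 1) = k - 1"
    using less_imp_diff_less[of k k 1] by (auto simp: swap_value_def)
  show "admissible k (swap_parts k X)"
    using assms gt low by (fastforce simp: admissible_def swap_parts_def)
  have le: "swap_value k (apex k X) v \<le> Max_mset X" if "v \<in># X" for v
  proof (cases "k < v \<and> v < apex k X")
    case True
    with swap_value_range(2)[OF A(1), of v] A(3) show ?thesis by linarith
  next
    case False
    with that show ?thesis by (auto simp: swap_value_def)
  qed
  show max: "Max_mset (swap_parts k X) = Max_mset X"
  proof (rule Max_mset_eqI)
    show "Max_mset X \<in># swap_parts k X"
      unfolding swap_parts_def using mem top by (metis image_eqI set_image_mset)
  qed (use le in \<open>auto simp: swap_parts_def\<close>)
  show "apex k (swap_parts k X) = apex k X" unfolding apex_def max ..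
qed

lemma swap_parts_involution:
  assumes "admissible k X"
  shows "swap_parts k (swap_parts k X) = X"
proof -
  have "swap_parts k (swap_parts k X) =
      image_mset (swap_value k (apex k X) \<circ> swap_value k (apex k X)) X"
    using swap_parts_properties(3)[OF assms]
    by (simp add: swap_parts_def multiset.map_comp)
  also have "swap_value k (apex k X) \<circ> swap_value k (apex k X) = id"
    using swap_value_involution[OF apex_cases(1)[OF assms]] by auto
  finally show ?thesis by simp
qed

section \<open>Removing a repeated largest part of the second kind\<close>

text \<open>
  When the largest part is \<open>M\<close> itself, \<open>M + 1\<close> has multiplicity 0 and nothing changes. The truncated
  subtraction is exact for the arguments of interest, where \<open>M\<close> occurs at most once.
\<close>

definition lower_top :: "nat \<Rightarrow> nat multiset \<Rightarrow> nat multiset" where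
  "lower_top k X = (let M = apex k X in
     if count X (Suc M) \<le> 1 then X
     else filter_mset (\<lambda>v. v \<noteq> k - 1 \<and> v < M) X
        + replicate_mset (count X (k - 1) + 2 * count X M) (k - 1)
        + replicate_mset (count X (Suc M) + 1 - count X M) M)"

text \<open>
  The value \<open>M\<close> is the same before and after: a modified partition has largest part \<open>M\<close>. The last
  conclusion is the test that tells from the image whether the partition was modified. Among the
  values of the first kind, \<open>k - 1\<close> and \<open>M\<close> may become repeated; the exchange leaves these two in
  place, so no repetition passes to the second kind.
\<close>

lemma lower_top_properties:
  assumes X: "admissible k X" and few: "\<And>v. odd (v + k) \<Longrightarrow> count X v \<le> 1"
  defines "M \<equiv> apex k X"
  shows "admissible k (lower_top k X)"
    "apex k (lower_top k X) = M"
    "Max_mset (lower_top k X) + size (lower_top k X) = Max_mset X + size X"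
    "count (lower_top k X) (Suc M) \<le> 1"
    "\<And>v. odd (v + k) \<Longrightarrow> v \<noteq> k - 1 \<Longrightarrow> v < M \<Longrightarrow> count (lower_top k X) v \<le> 1"
    "count (lower_top k X) M \<le> 1 \<longleftrightarrow> count X (Suc M) \<le> 1"
proof -
  note A = apex_cases[OF X, folded M_def]
  let ?Z = "lower_top k X"
  have t: "count X M \<le> 1" using few A(1) by blast
  have "admissible k ?Z \<and> apex k ?Z = M \<and> Max_mset ?Z + size ?Z = Max_mset X + size X \<and>
    count ?Z (Suc M) \<le> 1 \<and>
    (\<forall>v. odd (v + k) \<and> v \<noteq> k - 1 \<and> v < M \<longrightarrow> count ?Z v \<le> 1) \<and>
    (count ?Z M \<le> 1 \<longleftrightarrow> count X (Suc M) \<le> 1)"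
  proof (cases "count X (Suc M) \<le> 1")
    case True
    then have "?Z = X" by (simp add: lower_top_def M_def)
    with True t X few show ?thesis by (auto simp: M_def)
  next
    case False
    define R where "R = filter_mset (\<lambda>v. v \<noteq> k - 1 \<and> v < M) X"
    define s t r where "s = count X (k - 1)" and "t = count X M" and "r = count X (Suc M)"
    have tr: "t \<le> 1" "2 \<le> r" using \<open>count X M \<le> 1\<close> False by (auto simp: t_def r_def)
    have Z: "?Z = R + replicate_mset (s + 2 * t) (k - 1) + replicate_mset (r + 1 - t) M"
      using False by (simp add: lower_top_def Let_def R_def s_def t_def r_def M_def)
    have "Suc M \<in># X" using False by (metis count_eq_zero_iff le0 le_Suc_eq)
    then have "Suc M \<le> Max_mset X" by simp
    then have maxX: "Max_mset X = Suc M" using A(3) by linarith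
    have le: "v \<le> Suc M" if "v \<in># X" for v using that maxX by (metis Max_ge finite_set_mset)
    \<comment> \<open>The parts other than \<open>k - 1\<close>, \<open>M\<close>, \<open>M + 1\<close> are kept, so sizes can be compared.\<close>
    have "X = R + replicate_mset s (k - 1) + replicate_mset t M + replicate_mset r (Suc M)"
    proof (rule multiset_eqI)
      fix v
      have "count X v = 0" if "Suc M < v"
        using le[of v] that by (metis not_in_iff leD)
      then show "count X v = count (R + replicate_mset s (k - 1) + replicate_mset t M
          + replicate_mset r (Suc M)) v"
        using A(2) by (auto simp: R_def s_def t_def r_def nat_neq_iff less_Suc_eq_le)
    qed
    then have "size X = size R + s + t + r"
      by (metis size_replicate_mset size_union)
    then have size: "size ?Z = Suc (size X)" using tr by (simp add: Z)
    have memZ: "M \<in># ?Z" using tr by (auto simp: Z)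
    have maxZ: "Max_mset ?Z = M"
      by (rule Max_mset_eqI[OF memZ]) (use A(2) in \<open>auto simp: Z R_def split: if_splits\<close>)
    have "admissible k ?Z"
      using X memZ A(2) by (auto simp: admissible_def Z R_def split: if_splits)
    moreover have "apex k ?Z = M" using A(1) by (simp add: apex_def maxZ)
    moreover have "count ?Z (Suc M) \<le> 1" using A(2) by (auto simp: Z R_def)
    moreover have "count ?Z v \<le> 1" if "odd (v + k)" "v \<noteq> k - 1" "v < M" for v
      using few[of v] that by (auto simp: Z R_def)
    moreover have "\<not> count ?Z M \<le> 1" using A(2) tr by (auto simp: Z R_def)
    ultimately show ?thesis using False size maxZ maxX by auto
  qed
  then show "admissible k (lower_top k X)"
    "apex k (lower_top k X) = M"
    "Max_mset (lower_top k X) + size (lower_top k X) = Max_mset X + size X"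
    "count (lower_top k X) (Suc M) \<le> 1"
    "\<And>v. odd (v + k) \<Longrightarrow> v \<noteq> k - 1 \<Longrightarrow> v < M \<Longrightarrow> count (lower_top k X) v \<le> 1"
    "count (lower_top k X) M \<le> 1 \<longleftrightarrow> count X (Suc M) \<le> 1" by blast+
qed

text \<open>
  Equal images have the same \<open>M\<close> and agree on whether a modification took place. If it did, the old
  multiplicities of \<open>k - 1\<close> and \<open>M\<close> are the binary digits of the new multiplicity of \<open>k - 1\<close>, and the
  old multiplicity of \<open>M + 1\<close> follows from the new one of \<open>M\<close>.
\<close>

lemma lower_top_inj:
  assumes "k > 0"
  shows "inj_on (lower_top k) {X. admissible k X \<and> (\<forall>v. odd (v + k) \<longrightarrow> count X v \<le> 1)}"
proof (rule inj_onI, clarify)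
  fix X Y
  assume X: "admissible k X" "\<forall>v. odd (v + k) \<longrightarrow> count X v \<le> 1"
    and Y: "admissible k Y" "\<forall>v. odd (v + k) \<longrightarrow> count Y v \<le> 1"
    and eq: "lower_top k X = lower_top k Y"
  define M where "M = apex k X"
  have PX: "apex k (lower_top k X) = M" "count (lower_top k X) M \<le> 1 \<longleftrightarrow> count X (Suc M) \<le> 1"
    using lower_top_properties[OF X(1)] X(2) by (auto simp: M_def)
  have MY: "apex k Y = M" and PY: "count (lower_top k Y) M \<le> 1 \<longleftrightarrow> count Y (Suc M) \<le> 1"
    using lower_top_properties[OF Y(1)] Y(2) PX(1) eq by auto
  note A = apex_cases[OF X(1), folded M_def] apex_cases[OF Y(1), unfolded MY]
  show "X = Y"
  proof (cases "count X (Suc M) \<le> 1")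
    case True
    then have "count Y (Suc M) \<le> 1" using PX PY eq by simp
    with True eq show ?thesis by (simp add: lower_top_def MY flip: M_def)
  next
    case False
    then have FY: "\<not> count Y (Suc M) \<le> 1" using PX PY eq by simp
    have ZX: "count (lower_top k X) v =
        (if v = k - 1 then count X v + 2 * count X M
         else if v < M then count X v
         else if v = M then count X (Suc M) + 1 - count X M else 0)" for v
      using False A(2) by (auto simp: lower_top_def simp flip: M_def)
    have ZY: "count (lower_top k Y) v =
        (if v = k - 1 then count Y v + 2 * count Y M
         else if v < M then count Y v
         else if v = M then count Y (Suc M) + 1 - count Y M else 0)" for v
      using FY A(2) by (auto simp: lower_top_def MY)
    have bnd: "count X (k - 1) \<le> 1" "count Y (k - 1) \<le> 1" "count X M \<le> 1" "count Y M \<le> 1"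
      using X(2) Y(2) A(1) assms by (auto simp del: One_nat_def)
    have "count X (k - 1) + 2 * count X M = count Y (k - 1) + 2 * count Y M"
      using ZX[of "k - 1"] ZY[of "k - 1"] eq by simp
    with bnd have low: "count X (k - 1) = count Y (k - 1)" "count X M = count Y M"
      by presburger+
    have top: "count X (Suc M) = count Y (Suc M)"
      using ZX[of M] ZY[of M] eq low bnd A(2) by (auto split: if_splits)
    show ?thesis
    proof (rule multiset_eqI)
      fix v
      consider "v = k - 1" | "v < M" "v \<noteq> k - 1" | "v = M" | "v = Suc M" | "Suc M < v" by linarith
      then show "count X v = count Y v"
      proof cases
        case 5
        have "v \<notin># X" "v \<notin># Y"
          using 5 A(3,6) by (metis Max_ge finite_set_mset leD less_SucI less_or_eq_imp_le lessI order.strict_trans)+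
        then show ?thesis by (simp add: not_in_iff)
      qed (use low top ZX[of v] ZY[of v] eq in auto)
    qed
  qed
qed

section \<open>Comparing the two counts\<close>

text \<open>
  The composition of \<open>lower_top\<close> and \<open>swap_parts\<close> is the injection; the witness \<open>w\<close> consists of copies
  of \<open>k - 1\<close> only and is not \<open>admissible\<close>, so it is not an image.
\<close>

lemma card_other_parity_less:
  assumes k: "k \<ge> 2" and n: "n \<ge> k"
  shows "card (partition_msets (S_minus k) (\<lambda>v. odd (v + k)) n)
       < card (partition_msets (S_minus k) (\<lambda>v. even (v + k)) n)"
    (is "card ?G < card ?F")
proof -
  have S: "v \<noteq> 0 \<and> v \<notin> S_minus k \<longleftrightarrow> v = k - 1 \<or> k < v" for v
    using k by (auto simp: S_minus_def)
  define w where "w = replicate_mset (n + 2 - k) (k - 1)"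
  have "Max_mset w = k - 1" using n by (intro Max_mset_eqI) (auto simp: w_def)
  then have w: "w \<in> ?F"
    using k n S by (auto simp: partition_msets_def w_def split: if_splits)
  define f where "f = swap_parts k \<circ> lower_top k"
  have G: "admissible k X \<and> (\<forall>v. odd (v + k) \<longrightarrow> count X v \<le> 1)" if "X \<in> ?G" for X
  proof -
    have X: "X \<noteq> {#}" "\<forall>v\<in>#X. v = k - 1 \<or> k < v" "Max_mset X + size X = Suc n"
      "\<forall>v. odd (v + k) \<longrightarrow> count X v \<le> 1"
      using that S unfolding partition_msets_def by (blast, metis (mono_tags, lifting) IntI empty_iff mem_Collect_eq, blast, blast)
    \<comment> \<open>The value \<open>k - 1\<close> occurs at most once, and a single part \<open>k - 1\<close> has perimeter below \<open>k\<close>.\<close>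
    have "\<exists>v\<in>#X. k < v"
    proof (rule ccontr)
      assume "\<not> ?thesis"
      then have all: "v = k - 1" if "v \<in># X" for v using X(2) that by blast
      then have rep: "X = replicate_mset (size X) (k - 1)"
        by (metis set_mset_subset_singletonD singletonI subsetI)
      have "count X (k - 1) = size X" by (subst rep) simp
      moreover have "count X (k - 1) \<le> 1" using X(4) k by (auto simp del: One_nat_def)
      moreover have "Max_mset X = k - 1" using all X(1) by (metis Max_in finite_set_mset set_mset_eq_empty_iff)
      ultimately show False using X(3) k n by linarith
    qed
    with X show ?thesis by (auto simp: admissible_def)
  qed
  have "inj_on f ?G"
    unfolding f_def
  proof (rule comp_inj_on)
    show "inj_on (lower_top k) ?G"
      by (rule inj_on_subset[OF lower_top_inj]) (use G k in auto)
    show "inj_on (swap_parts k) (lower_top k ` ?G)"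
    proof (rule inj_on_inverseI[where g = "swap_parts k"])
      fix Z assume "Z \<in> lower_top k ` ?G"
      then have "admissible k Z" using lower_top_properties(1) G by blast
      then show "swap_parts k (swap_parts k Z) = Z" by (rule swap_parts_involution)
    qed
  qed
  moreover have "f ` ?G \<subseteq> ?F - {w}"
  proof
    fix Y assume "Y \<in> f ` ?G"
    then obtain X where X: "X \<in> ?G" and Y: "Y = swap_parts k (lower_top k X)"
      by (auto simp: f_def)
    define Z M where "Z = lower_top k X" and "M = apex k X"
    have GX: "admissible k X" "\<And>v. odd (v + k) \<Longrightarrow> count X v \<le> 1" using G[OF X] by auto
    note L = lower_top_properties[OF GX, folded Z_def, folded M_def]
    have apexZ: "apex k Z = M" by (rule L(2))
    note W = swap_parts_properties[OF L(1), folded Y[folded Z_def]]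
    note A = apex_cases[OF L(1), unfolded apexZ]
    have "size Y = size Z" by (simp add: Y Z_def swap_parts_def)
    then have "Max_mset Y + size Y = Suc n" using W(2) L(3) X by (simp add: partition_msets_def)
    moreover have "count Y v \<le> 1" if v: "even (v + k)" for v
    proof -
      have c: "count Y v = count Z (swap_value k M v)"
        using count_image_swap_value[OF A(1)] by (simp add: Y swap_parts_def apexZ flip: Z_def)
      \<comment> \<open>A part of the second kind differs from \<open>k - 1\<close> and \<open>M\<close>: it lies in an exchanged pair or on top.\<close>
      consider "v \<notin># Y" | "k < v" "v < M" | "v = Suc M"
      proof -
        have "v = Suc M \<or> v < M" if "v \<in># Y"
        proof -
          have "v \<le> Suc M" using Max_ge[OF finite_set_mset that] W(2) A(3) by linarith
          moreover have "v \<noteq> M" using A(1) v by blast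
          ultimately show ?thesis by linarith
        qed
        moreover have "k < v" if "v \<in># Y"
        proof -
          have "v \<noteq> k - 1" using v k by auto
          with W(1) that show ?thesis by (auto simp: admissible_def)
        qed
        ultimately show ?thesis using that by blast
      qed
      then show ?thesis
      proof cases
        case 1 then show ?thesis by (simp add: not_in_iff)
      next
        case 2
        with swap_value_range[OF A(1) 2] v L(5)[of "swap_value k M v"] c show ?thesis by simp
      next
        case 3
        then show ?thesis using c L(4) by (simp add: swap_value_def)
      qed
    qed
    moreover have "Y \<noteq> {#}" "Y \<noteq> w"
      using W(1) by (auto simp: admissible_def w_def split: if_splits)
    moreover have "0 \<notin># Y" "set_mset Y \<inter> S_minus k = {}"
      using W(1) S by (auto simp: admissible_def)
    ultimately show "Y \<in> ?F - {w}" by (simp add: partition_msets_def)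
  qed
  ultimately have "card ?G \<le> card (?F - {w})"
    using finite_partition_msets by (intro card_inj_on_le) auto
  also have "\<dots> < card ?F" using w finite_partition_msets by (metis card_Diff1_less)
  finally show ?thesis .
qed

theorem theorem1p6:
  fixes k n :: nat
  assumes "k \<ge> 2" and "n \<ge> k"
  shows "(even k \<longrightarrow> red (S_minus k) n > rod (S_minus k) n) \<and>
         (odd k \<longrightarrow> rod (S_minus k) n > red (S_minus k) n)"
proof (cases "even k")
  case True
  then have "(\<lambda>v. odd (v + k)) = odd" "(\<lambda>v. even (v + k)) = even" by auto
  with True card_other_parity_less[OF assms] show ?thesis
    by (simp add: red_eq_card rod_eq_card)
next
  case False
  then have "(\<lambda>v. odd (v + k)) = even" "(\<lambda>v. even (v + k)) = odd" by auto
  with False card_other_parity_less[OF assms] show ?thesis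
    by (simp add: red_eq_card rod_eq_card)
qed

end
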